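(* For every $k,q\in\mathbb{Z}_{>0}$, $$\chi^{\mathrm{quasi}}_{\widetilde Z_k}(q)=\frac{(q-1)(q-2)^k-(-2)^k(2q-1)}{q}+(-1)^k\sum_{j=0}^{k}\binom{k}{j}\gcd(j-1,q),$$ $$\chi^{\mathrm{quasi}}_{\widetilde N_k}(q)=\frac{(q-1)^k+(-1)^k(q-1)}{q}+\chi^{\mathrm{quasi}}_{\widetilde Z_k}(q),$$ where $\gcd(-1,q)=1$ and $\gcd(0,q)=q$.
   Context: $\mathbb{Z}_q:=\mathbb{Z}/q\mathbb{Z}$. Let $I_k$ be the $k\times k$ identity matrix, $J_k$ the $k\times k$ all-ones matrix, $1_k$ the all-ones column vector. $\widetilde N_k:=(I_k\mid J_k-I_k)\in\mathrm{Mat}_{k\times2k}(\mathbb{Z})$, $\widetilde Z_k:=(I_k\mid J_k-I_k\mid 1_k)\in\mathrm{Mat}_{k\times(2k+1)}(\mathbb{Z})$. For an integer matrix $G$ with $k$ rows and columns $g^1,\dots,g^n$, let $H_j(q):=\{u\in\mathbb{Z}_q^k\mid \sum_l u_lg^j_l=0\}$ and $\chi^{\mathrm{quasi}}_G(q):=\big|\mathbb{Z}_q^k\setminus\bigcup_{j=1}^nH_j(q)\big|$ (the number of $u\in\mathbb{Z}_q^k$ such that every entry of $uG$ is nonzero). *)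

theory Defs
  imports Complex_Main "HOL-Number_Theory.Residues" "Jordan_Normal_Form.Matrix"
begin

definition ones_vec :: "nat \<Rightarrow> int vec" where
  "ones_vec k = vec k (\<lambda>_. 1)"

definition ones_mat :: "nat \<Rightarrow> int mat" where
  "ones_mat k = mat k k (\<lambda>_. 1)"

definition N_tilde :: "nat \<Rightarrow> int mat" where
  "N_tilde k = mat_of_cols k (cols (1\<^sub>m k) @ cols (ones_mat k - 1\<^sub>m k))"

definition Z_tilde :: "nat \<Rightarrow> int mat" where
  "Z_tilde k = mat_of_cols k (cols (1\<^sub>m k) @ cols (ones_mat k - 1\<^sub>m k) @ [ones_vec k])"

(* The elements of Z/qZ are represented by the residues 0, ..., q - 1, so that vectors over
   Z/qZ are integer vectors with entries in this range and equations over Z/qZ are congruences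
   modulo q. This includes q = 1, where residue_ring has carrier {0}. *)
definition Zq_vecs :: "nat \<Rightarrow> nat \<Rightarrow> int vec set" where
  "Zq_vecs q k = {u \<in> carrier_vec k. \<forall>l<k. u $ l \<in> carrier (residue_ring (int q))}"

(* Columns are indexed from 0. A zero column modulo q gives the whole space. *)
definition hyperplane_mod :: "int mat \<Rightarrow> nat \<Rightarrow> nat \<Rightarrow> int vec set" where
  "hyperplane_mod G q j =
     {u \<in> Zq_vecs q (dim_row G). [(\<Sum>l<dim_row G. u $ l * G $$ (l, j)) = 0] (mod int q)}"

definition chi_quasi :: "int mat \<Rightarrow> nat \<Rightarrow> nat" where
  "chi_quasi G q =
     card (Zq_vecs q (dim_row G) - (\<Union>j<dim_col G. hyperplane_mod G q j))"

end

theory Submission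
  imports Defs
begin

text \<open>
  Sort the points \<open>u\<close> of the complement by the value \<open>s\<close> of their coordinate sum. For
  \<open>s \<noteq> 0\<close> the conditions on \<open>u\<close> say that all coordinates avoid \<open>0\<close> and \<open>s\<close>; for \<open>s = 0\<close> (which
  only occurs for \<open>N\<close>) they say that all coordinates avoid \<open>0\<close>. By inclusion-exclusion, counting
  words with letters outside a set \<open>A\<close> and prescribed sum reduces to counting words with
  letters in \<open>A\<close>. For \<open>A = {0, s}\<close> the latter is governed by the congruence \<open>j s = s\<close>, which has
  \<open>gcd (j - 1) q\<close> solutions \<open>s\<close> modulo \<open>q\<close>.
\<close>

section \<open>Words over an alphabet with prescribed sum modulo \<open>q\<close>\<close>

definition sum_words :: "nat \<Rightarrow> int set \<Rightarrow> nat \<Rightarrow> int \<Rightarrow> int list set" where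
  "sum_words q A k t = {xs. set xs \<subseteq> A \<and> length xs = k \<and> [sum_list xs = t] (mod int q)}"

lemma finite_sum_words:
  assumes "finite A"
  shows "finite (sum_words q A k t)"
  by (rule finite_subset[OF _ finite_lists_length_eq[OF assms, of k]])
    (auto simp: sum_words_def)

lemma card_sum_words_0: "card (sum_words q A 0 t) = of_bool ([0 = t] (mod int q))"
proof -
  have "sum_words q A 0 t = (if [0 = t] (mod int q) then {[]} else {})"
    by (auto simp: sum_words_def)
  then show ?thesis by simp
qed

lemma card_sum_words_Suc:
  assumes "finite A"
  shows "card (sum_words q A (Suc k) t) = (\<Sum>a\<in>A. card (sum_words q A k (t - a)))"
proof -
  have cong: "[a + s = t] (mod m) \<longleftrightarrow> [s = t - a] (mod m)" for a s m :: int
    by (simp add: cong_iff_dvd_diff algebra_simps)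
  have "sum_words q A (Suc k) t = (\<Union>a\<in>A. (#) a ` sum_words q A k (t - a))"
    by (auto simp: sum_words_def length_Suc_conv cong image_iff)
  also have "card \<dots> = (\<Sum>a\<in>A. card ((#) a ` sum_words q A k (t - a)))"
    by (rule card_UN_disjoint) (auto simp: assms finite_sum_words)
  also have "\<dots> = (\<Sum>a\<in>A. card (sum_words q A k (t - a)))"
    by (intro sum.cong refl card_image) simp
  finally show ?thesis .
qed

text \<open>For each word over \<open>A\<close> there is exactly one residue \<open>a\<close> such
  that its sum is congruent to \<open>t - a\<close>, so the sets on the left partition all words of
  length \<open>k\<close>.\<close>

lemma sum_card_sum_words_residues:
  assumes "q > 0" "finite A"
  shows "(\<Sum>a\<in>{0..int q - 1}. card (sum_words q A k (t - a))) = card A ^ k"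
proof -
  have "(\<Sum>a\<in>{0..int q - 1}. card (sum_words q A k (t - a)))
      = card (\<Union>a\<in>{0..int q - 1}. sum_words q A k (t - a))"
  proof (rule card_UN_disjoint[symmetric], goal_cases)
    case 3
    show ?case
    proof (intro ballI impI, rule ccontr)
      fix a b
      assume ab: "a \<in> {0..int q - 1}" "b \<in> {0..int q - 1}" "a \<noteq> b"
      assume "sum_words q A k (t - a) \<inter> sum_words q A k (t - b) \<noteq> {}"
      then have "[t - a = t - b] (mod int q)"
        by (auto simp: sum_words_def cong_def)
      then have "[a = b] (mod int q)"
        by (metis cong_diff cong_refl diff_diff_eq2 add_diff_cancel_left')
      with ab show False
        by (auto simp: cong_def)
    qed
  qed (auto simp: assms finite_sum_words)
  also have "(\<Union>a\<in>{0..int q - 1}. sum_words q A k (t - a)) = {xs. set xs \<subseteq> A \<and> length xs = k}"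
  proof safe
    fix xs :: "int list"
    assume xs: "set xs \<subseteq> A" "k = length xs"
    \<comment> \<open>The residue of \<open>t - sum_list xs\<close> is the index of the class that
      contains \<open>xs\<close>.\<close>
    have "[sum_list xs = t - (t - sum_list xs) mod int q] (mod int q)"
      by (simp add: cong_def mod_simps)
    then have "xs \<in> sum_words q A k (t - (t - sum_list xs) mod int q)"
      using xs by (simp add: sum_words_def)
    then show "xs \<in> (\<Union>a\<in>{0..int q - 1}. sum_words q A (length xs) (t - a))"
      using \<open>q > 0\<close> xs by (intro UN_I[of "(t - sum_list xs) mod int q"]) auto
  qed (auto simp: sum_words_def)
  also have "card \<dots> = card A ^ k"
    by (rule card_lists_length_eq[OF assms(2)])
  finally show ?thesis .
qed

text \<open>Letting the first letter range over all residues gives \<open>(q - m) ^ k\<close> words,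
  where \<open>m = card A\<close>; those with first letter in \<open>A\<close> are subtracted. Hence
  the main term satisfies \<open>c (k + 1) = (q - m) ^ k - m * c k\<close> with
  \<open>c 0 = 0\<close>. Its solution is the geometric sum \<open>(x ^ k - y ^ k) / (x - y)\<close>
  for \<open>x = q - m\<close> and \<open>y = - m\<close>, so that \<open>x - y = q\<close>.\<close>

lemma card_sum_words_compl:
  assumes "q > 0" "A \<subseteq> {0..int q - 1}"
  shows "real (card (sum_words q ({0..int q - 1} - A) k t)) =
    ((real q - real (card A)) ^ k - (- real (card A)) ^ k) / real q
    + (- 1) ^ k * real (card (sum_words q A k t))"
proof (induction k arbitrary: t)
  case 0
  show ?case by (simp add: card_sum_words_0)
next
  case (Suc k)
  let ?R = "{0..int q - 1}" and ?m = "real (card A)"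
  have fin: "finite A" using assms(2) finite_subset by blast
  have card_compl: "real (card (?R - A)) = real q - ?m"
    using assms fin card_mono[OF _ assms(2)] by (simp add: card_Diff_subset of_nat_diff)
  have "real (card (sum_words q (?R - A) (Suc k) t)) =
      (\<Sum>a\<in>?R - A. real (card (sum_words q (?R - A) k (t - a))))"
    by (simp add: card_sum_words_Suc)
  also have "\<dots> = (\<Sum>a\<in>?R. real (card (sum_words q (?R - A) k (t - a))))
      - (\<Sum>a\<in>A. real (card (sum_words q (?R - A) k (t - a))))"
    by (rule sum_diff) (use assms in auto)
  also have "(\<Sum>a\<in>?R. real (card (sum_words q (?R - A) k (t - a)))) = (real q - ?m) ^ k"
    using sum_card_sum_words_residues[OF assms(1), of "?R - A" k t]
    by (simp flip: of_nat_sum card_compl)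
  \<comment> \<open>The induction hypothesis is used at every target \<open>t - a\<close>; the
    first-letter recursion, read backwards, collects the counts over \<open>A\<close>.\<close>
  also have "(\<Sum>a\<in>A. real (card (sum_words q (?R - A) k (t - a)))) =
      ?m * (((real q - ?m) ^ k - (- ?m) ^ k) / real q)
      + (- 1) ^ k * real (card (sum_words q A (Suc k) t))"
    by (simp add: Suc.IH sum.distrib card_sum_words_Suc[OF fin] sum_distrib_left)
  finally show ?case
    using assms(1) by (simp add: field_simps)
qed

section \<open>Explicit counts for the alphabets \<open>{0}\<close> and
  \<open>{0, s}\<close>\<close>

lemma card_sum_words_singleton_0: "card (sum_words q {0} k t) = of_bool ([0 = t] (mod int q))"
  by (induction k arbitrary: t) (simp_all add: card_sum_words_0 card_sum_words_Suc)

lemma sum_binomial_Suc: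
  "(\<Sum>j=0..Suc k. (Suc k choose j) * f j) =
    (\<Sum>j=0..k. (k choose j) * f j) + (\<Sum>j=0..k. (k choose j) * f (Suc j))"
  for f :: "nat \<Rightarrow> nat"
proof -
  \<comment> \<open>The added top term vanishes because \<open>k choose Suc k = 0\<close>; after the
    shift Pascal's rule applies termwise.\<close>
  have "(\<Sum>j=0..k. (k choose j) * f j) = (\<Sum>j=0..Suc k. (k choose j) * f j)"
    by simp
  also have "\<dots> = f 0 + (\<Sum>j=0..k. (k choose Suc j) * f (Suc j))"
    by (subst sum.atLeast0_atMost_Suc_shift) simp
  finally show ?thesis
    by (subst sum.atLeast0_atMost_Suc_shift) (simp add: sum.distrib algebra_simps)
qed

text \<open>A word with exactly \<open>j\<close> letters \<open>s\<close> has sum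
  \<open>j * s\<close>, and there are \<open>k choose j\<close> such words. In the induction, the
  first letter \<open>0\<close> or \<open>s\<close> gives the two sums of Pascal's rule.\<close>

lemma card_sum_words_doubleton:
  assumes "s \<noteq> 0"
  shows "card (sum_words q {0, s} k t) =
    (\<Sum>j=0..k. (k choose j) * of_bool ([int j * s = t] (mod int q)))"
proof (induction k arbitrary: t)
  case 0
  show ?case by (simp add: card_sum_words_0)
next
  case (Suc k)
  have shift: "[int j * s = t - s] (mod int q) \<longleftrightarrow> [int (Suc j) * s = t] (mod int q)" for j
    by (simp add: cong_iff_dvd_diff algebra_simps)
  have "card (sum_words q {0, s} (Suc k) t) =
      card (sum_words q {0, s} k t) + card (sum_words q {0, s} k (t - s))"
    using assms by (simp add: card_sum_words_Suc)
  then show ?case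
    by (simp only: Suc.IH sum_binomial_Suc shift)
qed

text \<open>Dividing by \<open>g = gcd a q\<close> leaves \<open>d dvd b * s\<close> with
  \<open>d = q div g\<close> coprime to \<open>b\<close>. So the solutions are the multiples of
  \<open>d\<close> below \<open>q = d * g\<close>, and there are \<open>g\<close> of them.\<close>

lemma card_linear_congruence_solutions:
  assumes "q > 0"
  shows "int (card {s \<in> {0..int q - 1}. int q dvd a * s}) = gcd a (int q)"
proof -
  define g where "g = gcd a (int q)"
  define d where "d = int q div g"
  have g: "g > 0" using assms by (simp add: g_def)
  have q: "int q = d * g" by (simp add: d_def g_def)
  have d: "d > 0" using assms q g by (metis of_nat_0_less_iff zero_less_mult_pos2)
  obtain b where b: "a = b * g" unfolding g_def by (metis dvd_div_mult_self gcd_dvd1)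
  have cop: "coprime d b"
  proof -
    have "coprime (a div g) (int q div g)"
      unfolding g_def using assms by (intro div_gcd_coprime) auto
    moreover have "a div g = b" using b g by simp
    ultimately show ?thesis by (simp add: d_def coprime_commute)
  qed
  have "int q dvd a * s \<longleftrightarrow> d dvd s" for s
  proof -
    have "int q dvd a * s \<longleftrightarrow> d * g dvd (b * s) * g"
      unfolding q b by (simp add: mult_ac)
    also have "\<dots> \<longleftrightarrow> d dvd b * s" using g by simp
    also have "\<dots> \<longleftrightarrow> d dvd s" using cop by (simp add: coprime_dvd_mult_right_iff)
    finally show ?thesis .
  qed
  then have "{s \<in> {0..int q - 1}. int q dvd a * s} = {s \<in> {0..<d * g}. d dvd s}"
    by (auto simp flip: q)
  also have "\<dots> = (*) d ` {0..<g}"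
    using d by (auto simp: zero_le_mult_iff)
  also have "card \<dots> = nat g"
    using d by (subst card_image) (auto simp: inj_on_def)
  finally show ?thesis using g by (simp add: g_def)
qed

section \<open>From complements of hyperplanes to words\<close>

lemma card_Zq_vecs_filter:
  "card {u \<in> Zq_vecs q k. P (list_of_vec u)}
    = card {xs. set xs \<subseteq> {0..int q - 1} \<and> length xs = k \<and> P xs}"
proof (rule bij_betw_same_card[of list_of_vec], rule bij_betwI[where g = vec_of_list])
  show "list_of_vec \<in> {u \<in> Zq_vecs q k. P (list_of_vec u)}
      \<rightarrow> {xs. set xs \<subseteq> {0..int q - 1} \<and> length xs = k \<and> P xs}"
    by (auto simp: Zq_vecs_def residue_ring_def set_list_of_vec vec_set_def)
  show "vec_of_list \<in> {xs. set xs \<subseteq> {0..int q - 1} \<and> length xs = k \<and> P xs}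
      \<rightarrow> {u \<in> Zq_vecs q k. P (list_of_vec u)}"
  proof
    fix xs assume xs: "xs \<in> {xs. set xs \<subseteq> {0..int q - 1} \<and> length xs = k \<and> P xs}"
    then have "\<forall>l<k. xs ! l \<in> {0..int q - 1}"
      using nth_mem[of _ xs] by blast
    moreover have "vec_of_list xs \<in> carrier_vec k"
      using xs by (intro carrier_vecI) simp
    moreover have "carrier (residue_ring (int q)) = {0..int q - 1}"
      by (simp add: residue_ring_def)
    ultimately have "vec_of_list xs \<in> Zq_vecs q k"
      by (simp only: Zq_vecs_def vec_of_list_index mem_Collect_eq simp_thms)
    with xs show "vec_of_list xs \<in> {u \<in> Zq_vecs q k. P (list_of_vec u)}"
      by (simp only: mem_Collect_eq list_vec)
  qed
qed (simp_all add: vec_list list_vec)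

lemma N_tilde_dims: "dim_row (N_tilde k) = k" "dim_col (N_tilde k) = 2 * k"
  by (simp_all add: N_tilde_def ones_mat_def)

lemma Z_tilde_dims: "dim_row (Z_tilde k) = k" "dim_col (Z_tilde k) = Suc (2 * k)"
  by (simp_all add: Z_tilde_def ones_mat_def)

lemma N_tilde_index:
  assumes "l < k" "i < k"
  shows "N_tilde k $$ (l, i) = of_bool (l = i)" "N_tilde k $$ (l, k + i) = 1 - of_bool (l = i)"
  using assms
  by (simp_all add: N_tilde_def ones_mat_def mat_of_cols_index nth_append)

lemma Z_tilde_index:
  assumes "l < k"
  shows "j < 2 * k \<Longrightarrow> Z_tilde k $$ (l, j) = N_tilde k $$ (l, j)" "Z_tilde k $$ (l, 2 * k) = 1"
  using assms
  by (simp_all add: Z_tilde_def N_tilde_def ones_mat_def ones_vec_def mat_of_cols_index nth_append)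

lemma sum_vec_eq_sum_list:
  "u \<in> carrier_vec k \<Longrightarrow> (\<Sum>l<k. u $ l) = sum_list (list_of_vec u)"
  by (auto simp: list_of_vec_index sum_list_sum_nth atLeast0LessThan)

lemma N_tilde_column_sum:
  fixes u :: "int vec"
  assumes "u \<in> carrier_vec k" "i < k"
  shows "(\<Sum>l<k. u $ l * N_tilde k $$ (l, i)) = u $ i"
    and "(\<Sum>l<k. u $ l * N_tilde k $$ (l, k + i)) = sum_list (list_of_vec u) - u $ i"
proof -
  have unit: "(\<Sum>l<k. u $ l * of_bool (l = i)) = u $ i"
    using assms(2) by (simp add: of_bool_def if_distrib cong: if_cong)
  have "(\<Sum>l<k. u $ l * N_tilde k $$ (l, i)) = (\<Sum>l<k. u $ l * of_bool (l = i))"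
    using assms(2) by (intro sum.cong) (auto simp: N_tilde_index)
  then show "(\<Sum>l<k. u $ l * N_tilde k $$ (l, i)) = u $ i"
    using unit by simp
  have "(\<Sum>l<k. u $ l * N_tilde k $$ (l, k + i)) = (\<Sum>l<k. u $ l - u $ l * of_bool (l = i))"
    using assms(2) by (intro sum.cong) (auto simp: N_tilde_index)
  then show "(\<Sum>l<k. u $ l * N_tilde k $$ (l, k + i)) = sum_list (list_of_vec u) - u $ i"
    using unit by (simp add: sum_subtractf sum_vec_eq_sum_list[OF assms(1)])
qed

text \<open>Separates the column indices of the identity block from those of the block
  \<open>J - I\<close>.\<close>

lemma all_less_double: "(\<forall>j<2 * k. P j) \<longleftrightarrow> (\<forall>i<k. P i) \<and> (\<forall>i<k. P (k + i))" for k :: nat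
proof (intro iffI conjI allI impI)
  fix j assume *: "(\<forall>i<k. P i) \<and> (\<forall>i<k. P (k + i))" "j < 2 * k"
  show "P j"
  proof (cases "j < k")
    case False
    then have "j = k + (j - k)" "j - k < k" using *(2) by auto
    with *(1) show ?thesis by metis
  qed (use * in auto)
qed auto

text \<open>For the letter \<open>x\<close> at position \<open>i\<close>, the two conditions come
  from columns \<open>i\<close> and \<open>k + i\<close> of \<open>N_tilde\<close>. Quantifying over
  letters instead of positions prepares the passage to restricted alphabets.\<close>

definition avoids :: "nat \<Rightarrow> int list \<Rightarrow> bool" where
  "avoids q xs \<longleftrightarrow> (\<forall>x\<in>set xs. \<not> [x = 0] (mod int q) \<and> \<not> [sum_list xs - x = 0] (mod int q))"

lemma avoids_list_of_vec:
  assumes "u \<in> carrier_vec k"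
  shows "avoids q (list_of_vec u) \<longleftrightarrow>
    (\<forall>j<2 * k. \<not> [(\<Sum>l<k. u $ l * N_tilde k $$ (l, j)) = 0] (mod int q))"
  using assms unfolding all_less_double avoids_def all_set_conv_all_nth
  by (auto simp: N_tilde_column_sum list_of_vec_index)

lemma chi_quasi_N_tilde:
  "chi_quasi (N_tilde k) q =
    card {xs. set xs \<subseteq> {0..int q - 1} \<and> length xs = k \<and> avoids q xs}"
proof -
  have "Zq_vecs q k - (\<Union>j<2 * k. hyperplane_mod (N_tilde k) q j)
      = {u \<in> Zq_vecs q k. avoids q (list_of_vec u)}"
    unfolding hyperplane_mod_def N_tilde_dims
    by (auto simp: Zq_vecs_def avoids_list_of_vec)
  then show ?thesis by (simp add: chi_quasi_def N_tilde_dims card_Zq_vecs_filter)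
qed

text \<open>The first \<open>2 * k\<close> columns agree with those of \<open>N_tilde\<close>; the
  final all-ones column evaluates to the coordinate sum.\<close>

lemma chi_quasi_Z_tilde:
  "chi_quasi (Z_tilde k) q =
    card {xs. set xs \<subseteq> {0..int q - 1} \<and> length xs = k \<and>
      avoids q xs \<and> \<not> [sum_list xs = 0] (mod int q)}"
proof -
  have cols: "(\<Sum>l<k. u $ l * Z_tilde k $$ (l, j)) = (\<Sum>l<k. u $ l * N_tilde k $$ (l, j))"
    if "j < 2 * k" for u j
    using that by (intro sum.cong) (auto simp: Z_tilde_index)
  have last: "(\<Sum>l<k. u $ l * Z_tilde k $$ (l, 2 * k)) = sum_list (list_of_vec u)"
    if "u \<in> carrier_vec k" for u
    using that by (simp add: Z_tilde_index flip: sum_vec_eq_sum_list)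
  have "Zq_vecs q k - (\<Union>j<Suc (2 * k). hyperplane_mod (Z_tilde k) q j)
      = {u \<in> Zq_vecs q k. avoids q (list_of_vec u) \<and> \<not> [sum_list (list_of_vec u) = 0] (mod int q)}"
    unfolding hyperplane_mod_def Z_tilde_dims lessThan_Suc
    by (auto simp: Zq_vecs_def avoids_list_of_vec cols last)
  then show ?thesis
    unfolding chi_quasi_def Z_tilde_dims
    by (simp only: card_Zq_vecs_filter[of q k "\<lambda>xs. avoids q xs \<and> \<not> [sum_list xs = 0] (mod int q)"])
qed

section \<open>Classification of the avoiding words by their sum\<close>

lemma cong_residue_iff:
  assumes "a \<in> {0..int q - 1}" "b \<in> {0..int q - 1}"
  shows "[a = b] (mod int q) \<longleftrightarrow> a = b"
  using assms by (auto simp: cong_def)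

text \<open>Once the sum is fixed to \<open>s\<close>, the condition on
  \<open>sum_list xs - x\<close> involves only the letter \<open>x\<close>, and congruence of
  residues is equality. The condition on the whole word thus becomes a restriction of the
  alphabet.\<close>

lemma avoids_iff_letters:
  assumes "set xs \<subseteq> {0..int q - 1}" "s \<in> {0..int q - 1}" "[sum_list xs = s] (mod int q)"
  shows "avoids q xs \<longleftrightarrow> set xs \<inter> {0, s} = {}"
proof -
  have "[sum_list xs - x = 0] (mod int q) \<longleftrightarrow> x = s" if "x \<in> set xs" for x
  proof -
    have "[sum_list xs - x = 0] (mod int q) \<longleftrightarrow> [sum_list xs = x] (mod int q)"
      by (simp add: cong_iff_dvd_diff)
    also have "\<dots> \<longleftrightarrow> [s = x] (mod int q)"
      using assms(3) by (auto simp: cong_def)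
    also have "\<dots> \<longleftrightarrow> x = s"
      using cong_residue_iff[of s q x] assms that by auto
    finally show ?thesis .
  qed
  moreover have "[x = 0] (mod int q) \<longleftrightarrow> x = 0" if "x \<in> set xs" for x
    using cong_residue_iff[of x q 0] assms that by auto
  ultimately show ?thesis by (auto simp: avoids_def)
qed

lemma avoiding_words_with_sum:
  assumes "s \<in> {0..int q - 1}"
  shows "{xs. set xs \<subseteq> {0..int q - 1} \<and> length xs = k \<and> avoids q xs \<and> [sum_list xs = s] (mod int q)}
    = sum_words q ({0..int q - 1} - {0, s}) k s"
  using avoids_iff_letters[OF _ assms] by (auto simp: sum_words_def)

lemma finite_avoiding_words:
  "finite {xs. set xs \<subseteq> {0..int q - 1} \<and> length xs = k \<and> P xs}"
  by (rule finite_subset[OF _ finite_lists_length_eq[of "{0..int q - 1}" k]]) auto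

text \<open>The all-ones column excludes sum zero, so \<open>s\<close> starts at 1. For
  \<open>q = 1\<close> the range is empty and both sides are 0.\<close>

lemma chi_quasi_Z_tilde_sum:
  assumes "q > 0"
  shows "chi_quasi (Z_tilde k) q =
    (\<Sum>s\<in>{1..int q - 1}. card (sum_words q ({0..int q - 1} - {0, s}) k s))"
proof -
  let ?W = "\<lambda>s. {xs. set xs \<subseteq> {0..int q - 1} \<and> length xs = k \<and>
    avoids q xs \<and> [sum_list xs = s] (mod int q)}"
  have "{xs. set xs \<subseteq> {0..int q - 1} \<and> length xs = k \<and> avoids q xs \<and> \<not> [sum_list xs = 0] (mod int q)}
      = (\<Union>s\<in>{1..int q - 1}. ?W s)" (is "?L = ?R")
  proof
    show "?L \<subseteq> ?R"
    proof
      fix xs assume xs: "xs \<in> ?L"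
      let ?s = "sum_list xs mod int q"
      have "?s \<noteq> 0" using xs by (simp add: cong_def)
      moreover have "0 \<le> ?s" "?s < int q" using assms by auto
      ultimately have "?s \<in> {1..int q - 1}" by auto
      moreover have "xs \<in> ?W ?s" using xs by (simp add: cong_def)
      ultimately show "xs \<in> ?R" by blast
    qed
    show "?R \<subseteq> ?L"
      by (auto simp: cong_def)
  qed
  moreover have "card (\<Union>s\<in>{1..int q - 1}. ?W s) = (\<Sum>s\<in>{1..int q - 1}. card (?W s))"
    by (rule card_UN_disjoint) (auto simp: finite_avoiding_words cong_def)
  ultimately show ?thesis
    by (simp add: chi_quasi_Z_tilde avoiding_words_with_sum)
qed

text \<open>The avoiding words lost on adding the all-ones column are those with sum zero; for
  \<open>s = 0\<close> the forbidden set \<open>{0, s}\<close> collapses to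
  \<open>{0}\<close>.\<close>

lemma chi_quasi_N_tilde_eq_add:
  assumes "q > 0"
  shows "chi_quasi (N_tilde k) q =
    card (sum_words q ({0..int q - 1} - {0}) k 0) + chi_quasi (Z_tilde k) q"
proof -
  have "{xs. set xs \<subseteq> {0..int q - 1} \<and> length xs = k \<and> avoids q xs}
    = {xs. set xs \<subseteq> {0..int q - 1} \<and> length xs = k \<and> avoids q xs \<and> [sum_list xs = 0] (mod int q)}
    \<union> {xs. set xs \<subseteq> {0..int q - 1} \<and> length xs = k \<and> avoids q xs \<and> \<not> [sum_list xs = 0] (mod int q)}"
    by blast
  then have "chi_quasi (N_tilde k) q =
      card {xs. set xs \<subseteq> {0..int q - 1} \<and> length xs = k \<and> avoids q xs \<and> [sum_list xs = 0] (mod int q)}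
      + chi_quasi (Z_tilde k) q"
    unfolding chi_quasi_N_tilde chi_quasi_Z_tilde
    by (simp only:) (rule card_Un_disjoint, auto simp: finite_avoiding_words)
  with assms show ?thesis
    by (simp add: avoiding_words_with_sum)
qed

section \<open>Summation over \<open>s\<close> and the closed formulas\<close>

lemma sum_nonzero_solutions:
  assumes "q > 0"
  shows "(\<Sum>s\<in>{1..int q - 1}. of_bool (int q dvd a * s)) = real_of_int (gcd a (int q)) - 1"
proof -
  have "real_of_int (gcd a (int q)) = real (card {s \<in> {0..int q - 1}. int q dvd a * s})"
    by (simp flip: card_linear_congruence_solutions[OF assms])
  \<comment> \<open>The solution \<open>s = 0\<close> is always present and accounts for the
    \<open>- 1\<close>.\<close>
  also have "{s \<in> {0..int q - 1}. int q dvd a * s} = insert 0 {s \<in> {1..int q - 1}. int q dvd a * s}"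
    using assms by auto
  also have "real (card \<dots>) = 1 + real (card {s \<in> {1..int q - 1}. int q dvd a * s})"
    by (subst card_insert_disjoint) (auto intro: finite_subset[of _ "{1..int q - 1}"])
  finally show ?thesis
    by (simp add: Int_def)
qed

theorem theorem5p3:
  fixes k q :: nat
  assumes "k > 0" and "q > 0"
  shows "real (chi_quasi (Z_tilde k) q) =
           ((real q - 1) * (real q - 2) ^ k - (- 2) ^ k * (2 * real q - 1)) / real q
           + (- 1) ^ k * (\<Sum>j=0..k. real (k choose j) * real_of_int (gcd (int j - 1) (int q)))
         \<and> real (chi_quasi (N_tilde k) q) =
           ((real q - 1) ^ k + (- 1) ^ k * (real q - 1)) / real q + real (chi_quasi (Z_tilde k) q)"
proof
  let ?R = "{0..int q - 1}"
  let ?c = "((real q - 2) ^ k - (- 2) ^ k) / real q"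
  let ?G = "\<Sum>j=0..k. real (k choose j) * real_of_int (gcd (int j - 1) (int q))"
  have cong: "[int j * s = s] (mod int q) \<longleftrightarrow> int q dvd (int j - 1) * s" for j s
    by (simp add: cong_iff_dvd_diff algebra_simps)
  \<comment> \<open>Here \<open>s\<close> is nonzero, so \<open>{0, s}\<close> has two elements and
    the constant \<open>?c\<close> is the main term for \<open>m = 2\<close>.\<close>
  have summand: "real (card (sum_words q (?R - {0, s}) k s)) =
      ?c + (- 1) ^ k * (\<Sum>j=0..k. real (k choose j) * of_bool (int q dvd (int j - 1) * s))"
    if "s \<in> {1..int q - 1}" for s
    using that card_sum_words_compl[OF assms(2), of "{0, s}" k s]
    by (simp add: card_sum_words_doubleton cong)
  have "real (chi_quasi (Z_tilde k) q) =
      (real q - 1) * ?c + (- 1) ^ k *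
        (\<Sum>s\<in>{1..int q - 1}. \<Sum>j=0..k. real (k choose j) * of_bool (int q dvd (int j - 1) * s))"
    using assms(2)
    by (simp only: chi_quasi_Z_tilde_sum of_nat_sum summand sum.distrib sum_distrib_left[symmetric] cong: sum.cong)
      (simp add: of_nat_diff)
  \<comment> \<open>After exchanging the sums, the inner one counts the nonzero solutions of
    \<open>(j - 1) * s = 0\<close> modulo \<open>q\<close>.\<close>
  also have "(\<Sum>s\<in>{1..int q - 1}. \<Sum>j=0..k. real (k choose j) * of_bool (int q dvd (int j - 1) * s))
      = (\<Sum>j=0..k. real (k choose j) * (real_of_int (gcd (int j - 1) (int q)) - 1))"
    by (subst sum.swap) (simp only: sum_distrib_left[symmetric] sum_nonzero_solutions[OF assms(2)])
  also have "\<dots> = ?G - 2 ^ k"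
    by (simp add: algebra_simps sum_subtractf atLeast0AtMost flip: of_nat_sum choose_row_sum)
  \<comment> \<open>Since \<open>(- 1) ^ k * 2 ^ k = (- 2) ^ k\<close>, the coefficient of
    \<open>(- 2) ^ k\<close> is \<open>- (q - 1) / q - 1 = - (2 * q - 1) / q\<close>.\<close>
  also have "(real q - 1) * ?c + (- 1) ^ k * (?G - 2 ^ k) =
      ((real q - 1) * (real q - 2) ^ k - (- 2) ^ k * (2 * real q - 1)) / real q + (- 1) ^ k * ?G"
    using assms(2) power_minus[of "2 :: real" k] by (simp add: field_simps)
  finally show "real (chi_quasi (Z_tilde k) q) = \<dots>" .
  \<comment> \<open>This is the case \<open>m = 1\<close>: only the zero word has all letters in
    \<open>{0}\<close>, and its sum is 0, so \<open>(- 1) ^ k\<close> is added to the main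
    term.\<close>
  have "real (card (sum_words q (?R - {0}) k 0)) =
      ((real q - 1) ^ k + (- 1) ^ k * (real q - 1)) / real q"
    using assms(2) card_sum_words_compl[OF assms(2), of "{0}" k 0]
    by (simp add: card_sum_words_singleton_0 field_simps)
  then show "real (chi_quasi (N_tilde k) q) =
      ((real q - 1) ^ k + (- 1) ^ k * (real q - 1)) / real q + real (chi_quasi (Z_tilde k) q)"
    by (simp add: chi_quasi_N_tilde_eq_add[OF assms(2)])
qed

end
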